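(* Let $\alpha$ be a confluent non-expansive partial action of a monoid $M$ on a weak pseudometric space $(X,d)$, and let $(Y,D)$ be its free (weak pseudometric) globalization. Then the canonical map $X\to Y$, $x\mapsto[e,x]$, is isometric, i.e. $D([e,x],[e,y])=d(x,y)$ for all $x,y\in X$.
   Context: A weak pseudometric on $X$ is a symmetric function $d:X\times X\to[0,\infty]$ satisfying the triangle inequality and $d(x,x)=0$. Partial action: a partial map $M\times X\to X$, $(u,x)\mapsto u\cdot x$, with $e\cdot x=x$ for all $x$ ($e$ the unit of $M$) and such that, whenever $v\cdot x$ is defined, $(uv)\cdot x$ is defined iff $u\cdot(v\cdot x)$ is defined, in which case they are equal. $\operatorname{dom}(u)$ is the set of $x\in X$ with $u\cdot x$ defined. It is non-expansive if $d(u\cdot x,u\cdot y)\le d(x,y)$ for all $u\in M$, $x,y\in\operatorname{dom}(u)$. Globalization: $Y=(M\times X)/{\simeq}$, where $\simeq$ is the equivalence relation generated by $(uv,x)\sim(u,v\cdot x)$ whenever $v\cdot x$ is defined; $[u,x]$ is the class of $(u,x)$. $M$ acts on $Y$ by $u\cdot[v,x]=[uv,x]$. The distance $D(a,b)$ on $Y$ is the infimum (with $\inf\emptyset=\infty$) of $\sum_{j=1}^n d(x_j,y_j)$ over all paths from $a$ to $b$, i.e. finite sequences $((u_j,x_j,y_j))_{j=1}^n$, $n\ge1$, $u_j\in M$, $x_j,y_j\in X$, with $[u_1,x_1]=a$, $[u_j,y_j]=[u_{j+1},x_{j+1}]$ for $1\le j<n$, and $[u_n,y_n]=b$. Confluence: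 A monoid presentation $\langle G\mid R\rangle$ consists of a set $G$ and a set $R\subset G^*\times G^*$ of directed reduction rules $l\to r$ ($G^*$ is the set of finite words over $G$). It induces a one-step reduction $w_1lw_2\to w_1rw_2$ on $G^*$; the presented monoid is $G^*$ modulo the equivalence relation generated by $\to$. A word is normal if no one-step reduction applies to it; a normal form of $w$ is a normal word equivalent to $w$. The presentation is confluent if there is no infinite sequence of one-step reductions, every word has a unique normal form, and no rule has a left side consisting of a single letter. Given a presentation of $M$, one-step reduction on $G^*\times X$ is defined by $(g_n\dots g_1,x)\to(g_n\dots g_2,g_1\cdot x)$ whenever $g_1\cdot x$ is defined, and $(w_1,x)\to(w_2,x)$ whenever $w_1\to w_2$ in $G^*$; normality and normal forms are defined as before. The partial action is confluent if $M$ has a confluent presentation $\langle G\mid R\rangle$ such that every element of $G^*\times X$ has a unique normal form and, whenever $(g_n\dots g_1)\cdot x=y$ holds in $X$ (with $g_i\in G$), $(g_n\dots g_1,x)$ can be transformed into $((),y)$ by finitely many one-step reductions, where $()$ is the empty word. *)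

theory Defs
  imports "HOL-Library.Extended_Nonnegative_Real"
begin

definition weak_pseudometric :: "('x \<Rightarrow> 'x \<Rightarrow> ennreal) \<Rightarrow> bool" where
  "weak_pseudometric d \<longleftrightarrow>
     (\<forall>x. d x x = 0) \<and> (\<forall>x y. d x y = d y x) \<and> (\<forall>x y z. d x z \<le> d x y + d y z)"

(* A partial map is a function into the option type: "act u x = None" means that u \<cdot> x is
   undefined.  The equation "act (u * v) x = act u y" below is an equation between options, so it
   says that one side is defined iff the other is, and that the values then agree. *)
definition partial_action :: "('m::monoid_mult \<Rightarrow> 'x \<Rightarrow> 'x option) \<Rightarrow> bool" where
  "partial_action act \<longleftrightarrow>
     (\<forall>x. act 1 x = Some x) \<and>
     (\<forall>u v x y. act v x = Some y \<longrightarrow> act (u * v) x = act u y)"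

definition nonexpansive :: "('m \<Rightarrow> 'x \<Rightarrow> 'x option) \<Rightarrow> ('x \<Rightarrow> 'x \<Rightarrow> ennreal) \<Rightarrow> bool" where
  "nonexpansive act d \<longleftrightarrow>
     (\<forall>u x y x' y'. act u x = Some x' \<longrightarrow> act u y = Some y' \<longrightarrow> d x' y' \<le> d x y)"


section \<open>The free globalization\<close>

inductive glob_step :: "('m::monoid_mult \<Rightarrow> 'x \<Rightarrow> 'x option) \<Rightarrow> 'm \<times> 'x \<Rightarrow> 'm \<times> 'x \<Rightarrow> bool"
  for act where
  "act v x = Some y \<Longrightarrow> glob_step act (u * v, x) (u, y)"

definition glob_rel :: "('m::monoid_mult \<Rightarrow> 'x \<Rightarrow> 'x option) \<Rightarrow> (('m \<times> 'x) \<times> ('m \<times> 'x)) set" where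
  "glob_rel act = {(p, q). equivclp (glob_step act) p q}"

definition glob_space :: "('m::monoid_mult \<Rightarrow> 'x \<Rightarrow> 'x option) \<Rightarrow> ('m \<times> 'x) set set" where
  "glob_space act = UNIV // glob_rel act"

definition glob_class :: "('m::monoid_mult \<Rightarrow> 'x \<Rightarrow> 'x option) \<Rightarrow> 'm \<Rightarrow> 'x \<Rightarrow> ('m \<times> 'x) set" where
  "glob_class act u x = glob_rel act `` {(u, x)}"

definition glob_path ::
  "('m::monoid_mult \<Rightarrow> 'x \<Rightarrow> 'x option) \<Rightarrow> ('m \<times> 'x) set \<Rightarrow> ('m \<times> 'x) set
    \<Rightarrow> ('m \<times> 'x \<times> 'x) list \<Rightarrow> bool" where
  "glob_path act a b ps \<longleftrightarrow>
     ps \<noteq> [] \<and>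
     (case hd ps of (u, x, y) \<Rightarrow> glob_class act u x = a) \<and>
     (\<forall>j. Suc j < length ps \<longrightarrow>
        (case ps ! j of (u, x, y) \<Rightarrow>
         case ps ! Suc j of (u', x', y') \<Rightarrow> glob_class act u y = glob_class act u' x')) \<and>
     (case last ps of (u, x, y) \<Rightarrow> glob_class act u y = b)"

(* Meant for a and b in glob_space act; the infimum over no paths is the top element \<infinity> of ennreal. *)
definition glob_dist ::
  "('m::monoid_mult \<Rightarrow> 'x \<Rightarrow> 'x option) \<Rightarrow> ('x \<Rightarrow> 'x \<Rightarrow> ennreal)
    \<Rightarrow> ('m \<times> 'x) set \<Rightarrow> ('m \<times> 'x) set \<Rightarrow> ennreal" where
  "glob_dist act d a b =
     (INF ps \<in> {ps. glob_path act a b ps}. (\<Sum>(u, x, y)\<leftarrow>ps. d x y))"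


section \<open>Confluence\<close>

definition normal :: "('a \<Rightarrow> 'a \<Rightarrow> bool) \<Rightarrow> 'a \<Rightarrow> bool" where
  "normal step p \<longleftrightarrow> (\<nexists>q. step p q)"

definition normal_form :: "('a \<Rightarrow> 'a \<Rightarrow> bool) \<Rightarrow> 'a \<Rightarrow> 'a \<Rightarrow> bool" where
  "normal_form step p q \<longleftrightarrow> normal step q \<and> equivclp step p q"

(* Words over G are the elements of "lists G"; since R \<subseteq> lists G \<times> lists G below, both sides of a
   step are words over G. *)
inductive word_step :: "'g set \<Rightarrow> ('g list \<times> 'g list) set \<Rightarrow> 'g list \<Rightarrow> 'g list \<Rightarrow> bool"
  for G R where
  "(l, r) \<in> R \<Longrightarrow> w1 \<in> lists G \<Longrightarrow> w2 \<in> lists G \<Longrightarrow>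
     word_step G R (w1 @ l @ w2) (w1 @ r @ w2)"

definition word_rel ::
  "'g set \<Rightarrow> ('g list \<times> 'g list) set \<Rightarrow> ('g list \<times> 'g list) set" where
  "word_rel G R = {(v, w). v \<in> lists G \<and> w \<in> lists G \<and> equivclp (word_step G R) v w}"

definition word_class ::
  "'g set \<Rightarrow> ('g list \<times> 'g list) set \<Rightarrow> 'g list \<Rightarrow> 'g list set" where
  "word_class G R w = word_rel G R `` {w}"

(* \<phi> is an isomorphism from the presented monoid (words over G modulo word_rel, with concatenation)
   onto the monoid 'm; a word w then stands for the element \<phi> (word_class G R w) of 'm. *)
definition presents ::
  "'g set \<Rightarrow> ('g list \<times> 'g list) set \<Rightarrow> ('g list set \<Rightarrow> 'm::monoid_mult) \<Rightarrow> bool" where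
  "presents G R \<phi> \<longleftrightarrow>
     R \<subseteq> lists G \<times> lists G \<and>
     bij_betw \<phi> (lists G // word_rel G R) UNIV \<and>
     \<phi> (word_class G R []) = 1 \<and>
     (\<forall>v\<in>lists G. \<forall>w\<in>lists G.
        \<phi> (word_class G R (v @ w)) = \<phi> (word_class G R v) * \<phi> (word_class G R w))"

definition confluent_presentation :: "'g set \<Rightarrow> ('g list \<times> 'g list) set \<Rightarrow> bool" where
  "confluent_presentation G R \<longleftrightarrow>
     (\<nexists>f :: nat \<Rightarrow> 'g list. \<forall>i. word_step G R (f i) (f (Suc i))) \<and>
     (\<forall>w\<in>lists G. \<exists>!v. normal_form (word_step G R) w v) \<and>
     (\<forall>(l, r)\<in>R. length l \<noteq> 1)"

(* The word g\<^sub>n \<dots> g\<^sub>1 is the list [g\<^sub>n, \<dots>, g\<^sub>1], so the letter acting first is the last list entry. *)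
inductive pair_step ::
  "'g set \<Rightarrow> ('g list \<times> 'g list) set \<Rightarrow> ('g list set \<Rightarrow> 'm::monoid_mult)
    \<Rightarrow> ('m \<Rightarrow> 'x \<Rightarrow> 'x option) \<Rightarrow> 'g list \<times> 'x \<Rightarrow> 'g list \<times> 'x \<Rightarrow> bool"
  for G R \<phi> act where
  act_letter: "w \<in> lists G \<Longrightarrow> g \<in> G \<Longrightarrow> act (\<phi> (word_class G R [g])) x = Some y \<Longrightarrow>
     pair_step G R \<phi> act (w @ [g], x) (w, y)"
| rewrite_word: "word_step G R w1 w2 \<Longrightarrow> pair_step G R \<phi> act (w1, x) (w2, x)"

(* A type cannot be quantified inside a formula, so the type 'g from which the generators of the
   presentation are taken is a parameter. *)
definition confluent_action ::
  "'g itself \<Rightarrow> ('m::monoid_mult \<Rightarrow> 'x \<Rightarrow> 'x option) \<Rightarrow> bool" where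
  "confluent_action (_ :: 'g itself) act \<longleftrightarrow>
     (\<exists>(G :: 'g set) R \<phi>.
        presents G R \<phi> \<and> confluent_presentation G R \<and>
        (\<forall>w\<in>lists G. \<forall>x. \<exists>!q. normal_form (pair_step G R \<phi> act) (w, x) q) \<and>
        (\<forall>w\<in>lists G. \<forall>x y. act (\<phi> (word_class G R w)) x = Some y \<longrightarrow>
           (pair_step G R \<phi> act)\<^sup>*\<^sup>* (w, x) ([], y)))"

end

theory Submission
  imports Defs
begin

text \<open>
  Represent every monoid element by a normal word, so that a path in the globalization becomes a
  sequence of triples \<open>(w, x, y)\<close> whose consecutive ends are equivalent under pair reduction.
  Consider a triple whose word is of maximal length and ends in the letter \<open>g\<close>. If \<open>g\<close> acts on both
  \<open>x\<close> and \<open>y\<close>, stripping \<open>g\<close> does not increase the cost, by non-expansiveness. Otherwise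
  \<open>(w, x)\<close> or \<open>(w, y)\<close> is normal. The neighbouring end reduces to it by stripping letters only, so by
  maximality the two ends coincide, and the two triples merge by the triangle inequality.
  Iterating ends with empty words only, where the path lives in \<open>X\<close> and the triangle inequality
  concludes.
\<close>

section \<open>Classes and paths in the globalization\<close>

text \<open>Single steps need only go to equivalent points, not to steps. This carries the
  equivalence defining the globalization over to pair reduction.\<close>

lemma equivclp_mono_map:
  assumes "equivclp r a b" and "\<And>a b. r a b \<Longrightarrow> equivclp s (f a) (f b)"
  shows "equivclp s (f a) (f b)"
  using assms(1)
proof (induction rule: equivclp_induct)
  case base
  show ?case by simp
next
  case (step y z)
  then show ?case
    by (meson assms(2) equivclp_sym equivclp_trans)
qed

lemma glob_class_eq_iff:
  "glob_class act u x = glob_class act v y \<longleftrightarrow> equivclp (glob_step act) (u, x) (v, y)"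
  unfolding glob_class_def glob_rel_def set_eq_iff
  by (simp, metis equivclp_refl equivclp_sym equivclp_trans)

text \<open>A single triple is already a path; for \<open>u = 1\<close> this gives the easy half of
  the isometry.\<close>

lemma glob_dist_class_le:
  "glob_dist act d (glob_class act u x) (glob_class act u y) \<le> d x y"
  unfolding glob_dist_def
  by (rule INF_lower2[of "[(u, x, y)]"]) (auto simp: glob_path_def)

lemma glob_path_single:
  "glob_path act a b [(u, x, y)] \<longleftrightarrow> glob_class act u x = a \<and> glob_class act u y = b"
  by (simp add: glob_path_def)

lemma glob_path_Cons:
  assumes "glob_path act a b ((u, x, y) # ps)" and "ps \<noteq> []"
  shows "glob_class act u x = a" and "glob_path act (glob_class act u y) b ps"
proof -
  obtain v x' y' qs where ps: "ps = (v, x', y') # qs"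
    using assms(2) by (metis list.exhaust prod_cases3)
  have link: "case ((u, x, y) # ps) ! j of (u, x, y) \<Rightarrow>
       case ((u, x, y) # ps) ! Suc j of (u', x', y') \<Rightarrow> glob_class act u y = glob_class act u' x'"
    if "Suc j < length ((u, x, y) # ps)" for j
    using assms(1) that by (simp add: glob_path_def)
  show "glob_class act u x = a"
    using assms(1) by (simp add: glob_path_def)
  have "glob_class act u y = glob_class act v x'"
    using link[of 0] ps by simp
  moreover have "case ps ! j of (u, x, y) \<Rightarrow>
       case ps ! Suc j of (u', x', y') \<Rightarrow> glob_class act u y = glob_class act u' x'"
    if "Suc j < length ps" for j
    using link[of "Suc j"] that by simp
  ultimately show "glob_path act (glob_class act u y) b ps"
    using assms(1) ps unfolding glob_path_def by simp
qed

section \<open>Word reduction and normal words\<close>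

lemma word_class_eq_iff:
  assumes "v \<in> lists G" and "w \<in> lists G"
  shows "word_class G R v = word_class G R w \<longleftrightarrow> equivclp (word_step G R) v w"
  using assms unfolding word_class_def word_rel_def set_eq_iff
  by (simp, metis equivclp_refl equivclp_sym equivclp_trans)

lemma word_step_append:
  assumes "word_step G R v w" and "u \<in> lists G" and "u' \<in> lists G"
  shows "word_step G R (u @ v @ u') (u @ w @ u')"
  using assms(1)
proof cases
  case (1 l r w1 w2)
  then have "word_step G R ((u @ w1) @ l @ (w2 @ u')) ((u @ w1) @ r @ (w2 @ u'))"
    using assms by (intro word_step.intros) auto
  with 1 show ?thesis by simp
qed

text \<open>A reduction of the prefix could be carried out in front of \<open>g\<close>. Hence
  stripping last letters never creates a new redex.\<close>

lemma normal_word_butlast: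
  assumes "normal (word_step G R) (w @ [g])" and "g \<in> G"
  shows "normal (word_step G R) w"
  using assms word_step_append[of G R w _ "[]" "[g]"] by (fastforce simp: normal_def)

text \<open>A rule with empty left side could be applied forever.\<close>
lemma normal_Nil:
  assumes "confluent_presentation G R" and "R \<subseteq> lists G \<times> lists G"
  shows "normal (word_step G R) []"
  unfolding normal_def
proof
  assume "\<exists>q. word_step G R [] q"
  then obtain r where r: "([], r) \<in> R"
    by (auto elim: word_step.cases)
  have "word_step G R (concat (replicate i r)) (concat (replicate (Suc i) r))" for i
  proof -
    have "concat (replicate i r) \<in> lists G"
      using r assms(2) by (induction i) auto
    then show ?thesis
      using word_step.intros[OF r, of "[]" G "concat (replicate i r)"] by simp
  qed
  then have "\<exists>f. \<forall>i. word_step G R (f i) (f (Suc i))"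
    by (intro exI allI)
  with assms(1) show False
    by (simp add: confluent_presentation_def)
qed

lemma normal_form_unique:
  assumes "\<exists>!q. normal_form step a q" and "normal step p" and "normal step q"
    and "equivclp step a p" and "equivclp step a q"
  shows "p = q"
  using assms unfolding normal_form_def by blast

section \<open>Normal forms of pairs, for one fixed presentation witnessing confluence\<close>

locale confluent_pairs =
  fixes G :: "'g set" and R and \<phi> :: "'g list set \<Rightarrow> 'm::monoid_mult"
    and act :: "'m \<Rightarrow> 'x \<Rightarrow> 'x option"
  assumes presents: "presents G R \<phi>"
    and confluent: "confluent_presentation G R"
    and unique_normal_form:
      "\<And>w x. w \<in> lists G \<Longrightarrow> \<exists>!q. normal_form (pair_step G R \<phi> act) (w, x) q"
    and act_reduces: "\<And>w x y. w \<in> lists G \<Longrightarrow> act (\<phi> (word_class G R w)) x = Some y \<Longrightarrow>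
      (pair_step G R \<phi> act)\<^sup>*\<^sup>* (w, x) ([], y)"
begin

abbreviation pair_eq :: "'g list \<times> 'x \<Rightarrow> 'g list \<times> 'x \<Rightarrow> bool" where
  "pair_eq \<equiv> equivclp (pair_step G R \<phi> act)"

abbreviation normal_word :: "'g list \<Rightarrow> bool" where
  "normal_word w \<equiv> w \<in> lists G \<and> normal (word_step G R) w"

abbreviation letter_act :: "'g \<Rightarrow> 'x \<Rightarrow> 'x option" where
  "letter_act g \<equiv> act (\<phi> (word_class G R [g]))"

lemma rules_in_lists: "R \<subseteq> lists G \<times> lists G"
  using presents by (simp add: presents_def)

lemma pair_eq_strip:
  "w \<in> lists G \<Longrightarrow> g \<in> G \<Longrightarrow> letter_act g x = Some y \<Longrightarrow> pair_eq (w @ [g], x) (w, y)"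
  by (intro r_into_equivclp act_letter)

lemma normal_pair_Nil: "normal (pair_step G R \<phi> act) ([], x)"
  using normal_Nil[OF confluent rules_in_lists]
  by (auto simp: normal_def elim: pair_step.cases)

lemma normal_pair_snoc:
  assumes "normal_word (w @ [g])" and "letter_act g x = None"
  shows "normal (pair_step G R \<phi> act) (w @ [g], x)"
  using assms by (auto simp: normal_def elim: pair_step.cases)

lemma normal_pair_cases:
  assumes "normal_word w"
  obtains "normal (pair_step G R \<phi> act) (w, x)"
  | w' g y where "w = w' @ [g]" "g \<in> G" "letter_act g x = Some y" "normal_word w'"
proof (cases w rule: rev_cases)
  case Nil
  then show ?thesis using that(1) normal_pair_Nil by simp
next
  case (snoc w' g)
  then have "g \<in> G" "normal_word w'"
    using assms normal_word_butlast by auto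
  then show ?thesis
    using that snoc assms normal_pair_snoc by (cases "letter_act g x") auto
qed

text \<open>Stripped normal words stay normal, so no rule ever applies and the normal form is
  reached by letting last letters act. Each such step shortens the word, hence the
  dichotomy.\<close>

lemma normal_pair_reached:
  assumes "normal_word w"
  shows "\<exists>v y. normal (pair_step G R \<phi> act) (v, y) \<and> pair_eq (w, x) (v, y)
    \<and> ((v, y) = (w, x) \<or> length v < length w)"
  using assms
proof (induction w arbitrary: x rule: length_induct)
  case (1 w)
  from 1(2) show ?case
  proof (cases rule: normal_pair_cases[where x = x])
    case 1
    then show ?thesis by (intro exI[of _ w] exI[of _ x]) simp
  next
    case (2 w' g y)
    \<comment> \<open>Both alternatives of the induction hypothesis give this weak bound; the
      stripped letter \<open>g\<close> makes it strict.\<close>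
    then obtain v z where "normal (pair_step G R \<phi> act) (v, z)" "pair_eq (w', y) (v, z)"
        "length v \<le> length w'"
      using "1"(1) by (metis Pair_inject length_append_singleton lessI less_imp_le order_refl)
    moreover have "pair_eq (w, x) (w', y)"
      using 2 pair_eq_strip by auto
    ultimately show ?thesis
      using 2 equivclp_trans by fastforce
  qed
qed

text \<open>By uniqueness \<open>(w, x)\<close> is the normal form of \<open>(v, y)\<close>. If the
  two differed, \<open>w\<close> would be strictly shorter than \<open>v\<close>.\<close>

lemma normal_pair_eqI:
  assumes "normal (pair_step G R \<phi> act) (w, x)" and "normal_word v" and "pair_eq (v, y) (w, x)"
    and "length v \<le> length w"
  shows "(v, y) = (w, x)"
proof -
  obtain u z where "normal (pair_step G R \<phi> act) (u, z)" "pair_eq (v, y) (u, z)"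
      "(u, z) = (v, y) \<or> length u < length v"
    using normal_pair_reached[OF assms(2)] by blast
  then show ?thesis
    using normal_form_unique[OF unique_normal_form[of v y]] assms by fastforce
qed

text \<open>Pairs with empty word are normal, so \<open>X\<close> embeds into the pairs modulo
  \<open>pair_eq\<close>.\<close>

lemma pair_eq_NilD: "pair_eq ([], x) ([], y) \<Longrightarrow> x = y"
  using normal_pair_eqI[OF normal_pair_Nil, of "[]"] normal_Nil[OF confluent rules_in_lists]
  by simp

section \<open>Chains of words and their cost\<close>

text \<open>The analogue of \<open>glob_path\<close> for words: \<open>pair_eq\<close> replaces
  equality of classes, and the end points are explicit pairs. The empty chain is allowed, so a chain
  can be cut at any triple.\<close>

fun chain :: "'g list \<times> 'x \<Rightarrow> ('g list \<times> 'x \<times> 'x) list \<Rightarrow> 'g list \<times> 'x \<Rightarrow> bool" where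
  "chain p [] q \<longleftrightarrow> pair_eq p q"
| "chain p ((w, x, y) # ps) q \<longleftrightarrow> pair_eq p (w, x) \<and> chain (w, y) ps q"

lemma chain_pair_eq_left: "pair_eq p p' \<Longrightarrow> chain p' ps q \<Longrightarrow> chain p ps q"
  by (cases ps) (simp, metis equivclp_trans, clarsimp, metis equivclp_trans)

lemma chain_append_Cons:
  "chain p (ps @ (w, x, y) # qs) q \<longleftrightarrow> chain p ps (w, x) \<and> chain (w, y) qs q"
  by (induction p ps "(w, x)" rule: chain.induct) auto

lemma chain_pair_eq_right: "chain p ps q \<Longrightarrow> pair_eq q q' \<Longrightarrow> chain p ps q'"
proof (induction p ps q rule: chain.induct)
  case (1 p q)
  then show ?case by (simp only: chain.simps) (rule equivclp_trans)
qed simp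

abbreviation cost :: "('x \<Rightarrow> 'x \<Rightarrow> ennreal) \<Rightarrow> ('g list \<times> 'x \<times> 'x) list \<Rightarrow> ennreal" where
  "cost d ps \<equiv> \<Sum>(w, x, y)\<leftarrow>ps. d x y"

text \<open>With empty words all links are equalities in \<open>X\<close>, and the triangle
  inequality adds up along the list.\<close>

lemma cost_chain_Nil_words:
  assumes "weak_pseudometric d" and "chain ([], x) ps ([], y)" and "\<forall>(w, _)\<in>set ps. w = []"
  shows "d x y \<le> cost d ps"
  using assms(2,3)
proof (induction ps arbitrary: x)
  case Nil
  then show ?case using pair_eq_NilD assms(1) by (auto simp: weak_pseudometric_def)
next
  case (Cons p ps)
  then obtain a b where p: "p = ([], a, b)" "x = a" "chain ([], b) ps ([], y)"
    using pair_eq_NilD by (cases p) auto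
  then have "d b y \<le> cost d ps"
    using Cons by auto
  have "d a y \<le> d a b + d b y"
    using assms(1) by (simp add: weak_pseudometric_def)
  also have "\<dots> \<le> d a b + cost d ps"
    using \<open>d b y \<le> cost d ps\<close> by (rule add_left_mono)
  finally show ?case
    using p by simp
qed

lemma cost_chain:
  assumes d: "weak_pseudometric d" "nonexpansive act d"
    and "chain ([], x) ps ([], y)" and "\<forall>(w, _)\<in>set ps. normal_word w"
  shows "d x y \<le> cost d ps"
  using assms(3,4)
\<comment> \<open>Weighting a triple by its word length plus one makes both moves, stripping a
  letter and merging two triples, decrease the measure.\<close>
proof (induction ps rule: measure_induct_rule[of "\<lambda>ps. \<Sum>(w, _)\<leftarrow>ps. Suc (length w)"])
  case (less ps)
  have tri: "d a c \<le> d a b + d b c" for a b c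
    using d(1) by (simp add: weak_pseudometric_def)
  note IH = less.IH and path = less.prems(1) and nrm = less.prems(2)
  show ?case
  proof (cases "\<forall>(w, _)\<in>set ps. w = []")
    case True
    then show ?thesis using cost_chain_Nil_words d(1) path by blast
  next
    case False
    then have "ps \<noteq> []" by auto
    \<comment> \<open>Maximal length of the word supplies the length hypothesis of
      \<open>normal_pair_eqI\<close> for both neighbours.\<close>
    then obtain t where t: "t \<in> set ps" "\<forall>s\<in>set ps. length (fst s) \<le> length (fst t)"
      using Max_in[of "(length \<circ> fst) ` set ps"] Max_ge[of "(length \<circ> fst) ` set ps"] by fastforce
    obtain w a b where tw: "t = (w, a, b)" by (cases t)
    then obtain as bs where ps: "ps = as @ (w, a, b) # bs"
      using t(1) split_list by metis
    \<comment> \<open>Otherwise maximality would make every word empty.\<close>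
    have "w \<noteq> []"
      using False t(2) tw by fastforce
    then obtain w' g where w: "w = w' @ [g]"
      using rev_exhaust by blast
    have nw: "normal_word (w' @ [g])"
      using nrm ps w by auto
    then have nw': "normal_word w'" and g: "g \<in> G"
      using normal_word_butlast by auto
    have left: "chain ([], x) as (w, a)" and right: "chain (w, b) bs ([], y)"
      using path chain_append_Cons unfolding ps by auto
    show ?thesis
    proof (cases "letter_act g a")
      case None
      then have na: "normal (pair_step G R \<phi> act) (w, a)"
        using normal_pair_snoc nw w by simp
      show ?thesis
      proof (cases as rule: rev_cases)
        case Nil
        \<comment> \<open>Without a predecessor the starting pair takes its place, but its word is
          empty while \<open>w\<close> is not.\<close>
        then have "pair_eq ([], x) (w, a)" using left by simp
        then have "([], x) = (w, a)"
          using normal_pair_eqI[OF na, of "[]" x] normal_Nil[OF confluent rules_in_lists] by simp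
        with \<open>w \<noteq> []\<close> show ?thesis by simp
      next
        case (snoc as' s)
        obtain v a' b' where s: "s = (v, a', b')" by (cases s)
        have "pair_eq (v, b') (w, a)" "chain ([], x) as' (v, a')"
          using left unfolding snoc s chain_append_Cons by simp_all
        moreover have "normal_word v" "length v \<le> length w"
          using nrm t(2) by (simp_all add: ps snoc s tw)
        ultimately have eq: "(v, b') = (w, a)"
          using normal_pair_eqI[OF na] by blast
        \<comment> \<open>The predecessor ends exactly where the chosen triple starts, so both
          merge, skipping the common point \<open>a\<close>.\<close>
        then have "chain ([], x) (as' @ (w, a', b) # bs) ([], y)"
          using \<open>chain ([], x) as' (v, a')\<close> right by (simp add: chain_append_Cons)
        then have "d x y \<le> cost d (as' @ (w, a', b) # bs)"
          using nrm ps snoc by (intro IH) (auto simp: s)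
        also have "\<dots> \<le> cost d ps"
          using tri[of a' b a] eq
          by (simp add: ps snoc s add_left_mono add_right_mono flip: add.assoc)
        finally show ?thesis .
      qed
    next
      case a: (Some a1)
      show ?thesis
      proof (cases "letter_act g b")
        \<comment> \<open>Mirror image: now the right end is normal, and the triple merges with its
          successor.\<close>
        case None
        then have nb: "normal (pair_step G R \<phi> act) (w, b)"
          using normal_pair_snoc nw w by simp
        show ?thesis
        proof (cases bs)
          case Nil
          then have "pair_eq ([], y) (w, b)" using right equivclp_sym by auto
          then have "([], y) = (w, b)"
            using normal_pair_eqI[OF nb, of "[]" y] normal_Nil[OF confluent rules_in_lists] by simp
          with \<open>w \<noteq> []\<close> show ?thesis by simp
        next
          case (Cons s bs')
          obtain v a' b' where s: "s = (v, a', b')" by (cases s)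
          have "pair_eq (v, a') (w, b)" "chain (v, b') bs' ([], y)"
            using right unfolding Cons s by (simp_all add: equivclp_sym)
          moreover have "normal_word v" "length v \<le> length w"
            using nrm t(2) by (simp_all add: ps Cons s tw)
          ultimately have eq: "(v, a') = (w, b)"
            using normal_pair_eqI[OF nb] by blast
          then have "chain ([], x) (as @ (w, a, b') # bs') ([], y)"
            using left \<open>chain (v, b') bs' ([], y)\<close> by (simp add: chain_append_Cons)
          then have "d x y \<le> cost d (as @ (w, a, b') # bs')"
            using nrm ps Cons by (intro IH) (auto simp: s)
          also have "\<dots> \<le> cost d ps"
            using tri[of a b' b] eq
            by (simp add: ps Cons s add_left_mono add_right_mono flip: add.assoc)
          finally show ?thesis .
        qed
      next
        case b: (Some b1)
        \<comment> \<open>Here \<open>g\<close> acts on both ends: stripping it keeps the links, and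
          the cost cannot grow by non-expansiveness.\<close>
        have "pair_eq (w, a) (w', a1)" "pair_eq (w', b1) (w, b)"
          using pair_eq_strip[of w' g] nw' g a b unfolding w by (simp_all add: equivclp_sym)
        then have "chain ([], x) (as @ (w', a1, b1) # bs) ([], y)"
          using chain_pair_eq_right[OF left] chain_pair_eq_left[OF _ right]
          by (simp add: chain_append_Cons)
        then have "d x y \<le> cost d (as @ (w', a1, b1) # bs)"
          using nrm nw' ps w by (intro IH) auto
        also have "\<dots> \<le> cost d ps"
          using d(2) a b unfolding ps nonexpansive_def
          by (auto intro!: add_left_mono add_right_mono)
        finally show ?thesis .
      qed
    qed
  qed
qed

section \<open>From the globalization to chains of normal words\<close>

text \<open>Letters act from the right end of the word, so a prefix is never in the way.\<close>

lemma pair_step_append: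
  assumes "pair_step G R \<phi> act p q" and "u \<in> lists G"
  shows "pair_step G R \<phi> act (u @ fst p, snd p) (u @ fst q, snd q)"
  using assms(1)
proof cases
  case (act_letter w g x y)
  then show ?thesis
    using pair_step.act_letter[of "u @ w" G g act \<phi> R x y] assms(2) by simp
next
  case (rewrite_word w1 w2 x)
  then show ?thesis
    using pair_step.rewrite_word word_step_append[of G R w1 w2 u "[]"] assms(2) by fastforce
qed

lemma pair_eq_append:
  assumes "pair_eq (v, x) (w, y)" and "u \<in> lists G"
  shows "pair_eq (u @ v, x) (u @ w, y)"
proof -
  let ?f = "\<lambda>p. (u @ fst p, snd p)"
  have "pair_eq (?f (v, x)) (?f (w, y))"
    using assms(1)
    by (rule equivclp_mono_map) (intro r_into_equivclp pair_step_append assms(2))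
  then show ?thesis by simp
qed

lemma word_eq_imp_pair_eq:
  assumes "equivclp (word_step G R) v w"
  shows "pair_eq (v, x) (w, x)"
  using assms by (rule equivclp_mono_map) (intro r_into_equivclp rewrite_word)

text \<open>Injectivity of \<open>\<phi>\<close> turns equal monoid elements into equivalent
  words.\<close>

lemma word_class_imp_pair_eq:
  assumes "v \<in> lists G" and "w \<in> lists G"
    and "\<phi> (word_class G R v) = \<phi> (word_class G R w)"
  shows "pair_eq (v, x) (w, x)"
proof -
  have "inj_on \<phi> (lists G // word_rel G R)"
    using presents by (simp add: presents_def bij_betw_def)
  moreover have "word_class G R u \<in> lists G // word_rel G R" if "u \<in> lists G" for u
    using that by (simp add: word_class_def quotientI)
  ultimately have "word_class G R v = word_class G R w"
    using assms by (meson inj_onD)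
  then show ?thesis
    using assms(1,2) by (intro word_eq_imp_pair_eq) (simp add: word_class_eq_iff)
qed

lemma normal_word_exists: "\<exists>w. normal_word w \<and> \<phi> (word_class G R w) = u"
proof -
  have "u \<in> \<phi> ` (lists G // word_rel G R)"
    using presents by (auto simp: presents_def bij_betw_def)
  then obtain v where v: "v \<in> lists G" "\<phi> (word_class G R v) = u"
    unfolding quotient_def word_class_def by blast
  then have "\<exists>!w. normal_form (word_step G R) v w"
    using confluent by (simp add: confluent_presentation_def)
  then obtain w where w: "normal (word_step G R) w" "equivclp (word_step G R) v w"
    unfolding normal_form_def by blast
  \<comment> \<open>A step in either direction stays among words over \<open>G\<close>, because both
    sides of every rule lie there.\<close>
  have "w \<in> lists G"
    using w(2)
  proof (induction rule: equivclp_induct)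
    case (step y z)
    have "v \<in> lists G \<and> w \<in> lists G" if "word_step G R v w" for v w
      using that rules_in_lists by cases auto
    then show ?case using step by blast
  qed (use v in simp)
  then have "word_class G R v = word_class G R w"
    using v w by (simp add: word_class_eq_iff)
  then show ?thesis
    using v w \<open>w \<in> lists G\<close> by auto
qed

text \<open>The word chosen is unique: it is the common normal form of all words presenting
  \<open>u\<close>.\<close>

definition rep :: "'m \<Rightarrow> 'g list" where
  "rep u = (SOME w. normal_word w \<and> \<phi> (word_class G R w) = u)"

lemma normal_word_rep: "normal_word (rep u)" and class_rep: "\<phi> (word_class G R (rep u)) = u"
  using someI_ex[OF normal_word_exists[of u]] unfolding rep_def by auto

text \<open>The words \<open>rep (u * v)\<close> and \<open>rep u @ rep v\<close> present the same
  element. By \<open>act_reduces\<close> the suffix \<open>rep v\<close> is consumed in turning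
  \<open>x\<close> into \<open>y\<close>, which leaves \<open>rep u\<close>.\<close>

lemma glob_step_imp_pair_eq:
  assumes "glob_step act p q"
  shows "pair_eq (rep (fst p), snd p) (rep (fst q), snd q)"
  using assms
proof cases
  case (1 v x y u)
  note in_lists = normal_word_rep[THEN conjunct1]
  have "\<phi> (word_class G R (rep u @ rep v)) = u * v"
    using presents in_lists class_rep unfolding presents_def by simp
  then have "pair_eq (rep (u * v), x) (rep u @ rep v, x)"
    using in_lists class_rep by (intro word_class_imp_pair_eq) auto
  moreover have "pair_eq (rep v, x) ([], y)"
    using 1 in_lists by (intro rtranclp_into_equivclp act_reduces) (simp_all add: class_rep)
  then have "pair_eq (rep u @ rep v, x) (rep u, y)"
    using pair_eq_append[of "rep v" x "[]" y "rep u"] in_lists by simp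
  ultimately show ?thesis
    using 1 by (auto dest: equivclp_trans)
qed

lemma glob_class_imp_pair_eq:
  assumes "glob_class act u x = glob_class act v y"
  shows "pair_eq (rep u, x) (rep v, y)"
proof -
  let ?f = "\<lambda>p. (rep (fst p), snd p)"
  have "pair_eq (?f (u, x)) (?f (v, y))"
    using assms unfolding glob_class_eq_iff
    by (rule equivclp_mono_map) (rule glob_step_imp_pair_eq)
  then show ?thesis by simp
qed

lemma glob_path_imp_chain:
  assumes "glob_path act (glob_class act u x) (glob_class act v y) ps"
  shows "chain (rep u, x) (map (\<lambda>(u, x, y). (rep u, x, y)) ps) (rep v, y)"
  using assms
proof (induction ps arbitrary: u x)
  case Nil
  then show ?case by (simp add: glob_path_def)
next
  case (Cons p ps)
  obtain u' a b where p: "p = (u', a, b)" by (cases p)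
  show ?case
  proof (cases "ps = []")
    case True
    then show ?thesis
      using Cons.prems glob_class_imp_pair_eq p by (auto simp: glob_path_single)
  next
    case False
    then show ?thesis
      using Cons glob_path_Cons[of act _ _ u' a b ps] glob_class_imp_pair_eq p by auto
  qed
qed

section \<open>The isometry\<close>

lemma dist_le_glob_dist:
  assumes "weak_pseudometric d" and "nonexpansive act d"
  shows "d x y \<le> glob_dist act d (glob_class act 1 x) (glob_class act 1 y)"
  unfolding glob_dist_def
proof (rule INF_greatest, clarify)
  fix ps assume path: "glob_path act (glob_class act 1 x) (glob_class act 1 y) ps"
  let ?qs = "map (\<lambda>(u, x, y). (rep u, x, y)) ps"
  \<comment> \<open>Both words present the unit, so the ends of the chain can be moved to
    \<open>[]\<close> as \<open>cost_chain\<close> requires.\<close>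
  have one: "pair_eq ([], z) (rep 1, z)" for z
    using word_class_imp_pair_eq[of "[]" "rep 1" z] normal_word_rep class_rep presents
    by (simp add: presents_def)
  have "chain ([], x) ?qs ([], y)"
    using chain_pair_eq_left[OF one glob_path_imp_chain[OF path]] equivclp_sym[OF one]
    by (rule chain_pair_eq_right)
  then have "d x y \<le> cost d ?qs"
    using normal_word_rep by (intro cost_chain assms) auto
  also have "cost d ?qs = (\<Sum>(u, x, y)\<leftarrow>ps. d x y)"
    by (simp add: case_prod_unfold comp_def)
  finally show "d x y \<le> (\<Sum>(u, x, y)\<leftarrow>ps. d x y)" .
qed

end

theorem theorem5p4:
  fixes act :: "'m::monoid_mult \<Rightarrow> 'x \<Rightarrow> 'x option"
    and d :: "'x \<Rightarrow> 'x \<Rightarrow> ennreal"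
  assumes "weak_pseudometric d"
    and "partial_action act"
    and "nonexpansive act d"
    and "confluent_action TYPE('g) act"
  shows "\<forall>x y. glob_dist act d (glob_class act 1 x) (glob_class act 1 y) = d x y"
proof -
  obtain G :: "'g set" and R \<phi> where "presents G R \<phi>" "confluent_presentation G R"
      "\<forall>w\<in>lists G. \<forall>x. \<exists>!q. normal_form (pair_step G R \<phi> act) (w, x) q"
      "\<forall>w\<in>lists G. \<forall>x y. act (\<phi> (word_class G R w)) x = Some y \<longrightarrow>
         (pair_step G R \<phi> act)\<^sup>*\<^sup>* (w, x) ([], y)"
    using assms(4) unfolding confluent_action_def by (elim exE conjE)
  then interpret confluent_pairs G R \<phi> act
    by unfold_locales simp_all
  show ?thesis
    by (intro allI order_antisym glob_dist_class_le dist_le_glob_dist assms(1,3))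
qed

end
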